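(* The number $B_{m,n}$ of bimonotone subdivisions of the point configuration $P_{m,n}$ is given by $$B_{m,n}=\frac{2^{m-2}}{(n-1)!}\,P_n(m),$$ where $P_n(m)$ is some monic polynomial (in $m$, depending on $n$) of degree $n-1$.
   Context: For positive integers $m,n$, the point configuration $P_{m,n}\subset\mathbb R^2$ is the grid with two rows, aligned at the left, having $m$ points in the top row and $n$ points in the bottom row, with the bottom left point at the origin: the bottom points are $(0,0),(1,0),\dots,(n-1,0)$ and the top points are $(0,1),(1,1),\dots,(m-1,1)$. (The name $P_{m,n}$ of the configuration is unrelated to the polynomial $P_n$.) A subdivision of a point configuration $\mathcal A\subset\mathbb R^2$ is a collection of convex polygons whose vertices lie in $\mathcal A$ such that the union of the polygons is the convex hull of $\mathcal A$ and each pair of polygons either does not intersect or intersects at a common vertex or side. Not all points of $\mathcal A$ need to be used as vertices of the polygons. A bimonotone polygon is a polygon all of whose edges are vertical or have nonnegative slope. A bimonotone subdivision is a subdivision all of whose polygons are bimonotone. $B_{m,n}$ denotes the number of bimonotone subdivisions of $P_{m,n}$, with the convention $B_{1,1}=\tfrac12$ for the degenerate configuration $P_{1,1}$.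
   Formalization: The formula is proved for m ≥ n only; for m < n the right side of the hull has negative slope, so B_{m,n} = 0 and the formula fails (B_{2,2} = 2 forces P_2(m) = m, giving 1/2 instead of B_{1,2} = 0). *)

theory Defs
  imports "HOL-Analysis.Analysis" "HOL-Computational_Algebra.Polynomial"
begin

definition convex_polygon :: "(real \<times> real) set \<Rightarrow> bool" where
  "convex_polygon K \<longleftrightarrow> polytope K \<and> aff_dim K = 2"

definition polygon_vertices :: "(real \<times> real) set \<Rightarrow> (real \<times> real) set" where
  "polygon_vertices K = {v. v extreme_point_of K}"

definition subdivision :: "(real \<times> real) set \<Rightarrow> (real \<times> real) set set \<Rightarrow> bool" where
  "subdivision A S \<longleftrightarrow>
     (\<forall>K\<in>S. convex_polygon K \<and> polygon_vertices K \<subseteq> A) \<and>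
     \<Union>S = convex hull A \<and>
     (\<forall>K\<in>S. \<forall>L\<in>S. K \<noteq> L \<longrightarrow>
        K \<inter> L = {} \<or>
        (\<exists>v \<in> polygon_vertices K \<inter> polygon_vertices L. K \<inter> L = {v}) \<or>
        (K \<inter> L edge_of K \<and> K \<inter> L edge_of L))"

definition bimonotone_polygon :: "(real \<times> real) set \<Rightarrow> bool" where
  "bimonotone_polygon K \<longleftrightarrow> convex_polygon K \<and>
     (\<forall>p q. closed_segment p q edge_of K \<longrightarrow>
        fst p = fst q \<or> (snd q - snd p) / (fst q - fst p) \<ge> 0)"

definition bimonotone_subdivision :: "(real \<times> real) set \<Rightarrow> (real \<times> real) set set \<Rightarrow> bool" where
  "bimonotone_subdivision A S \<longleftrightarrow> subdivision A S \<and> (\<forall>K\<in>S. bimonotone_polygon K)"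

definition two_row_grid :: "nat \<Rightarrow> nat \<Rightarrow> (real \<times> real) set" where
  "two_row_grid m n = {(real i, 0) |i. i < n} \<union> {(real j, 1) |j. j < m}"

text \<open>The value is real rather than natural because of the convention \<open>1/2\<close> for the
  degenerate configuration, whose convex hull is a segment. If \<open>m < n\<close>, the right-hand side
  of the convex hull has negative slope and the number is 0.\<close>

definition num_bimonotone_subdivisions :: "nat \<Rightarrow> nat \<Rightarrow> real" where
  "num_bimonotone_subdivisions m n =
     (if m = 1 \<and> n = 1 then 1 / 2
      else real (card {S. bimonotone_subdivision (two_row_grid m n) S}))"

end

theory Submission imports Defs begin

text \<open>A polygon of a subdivision of the two-row grid is the trapezoid (possibly a triangle) between
  two non-horizontal lattice segments, and it is bimonotone iff neither segment leans to the left.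
  The rightmost polygon of a bimonotone subdivision is the unique one containing the midpoint of the
  right-hand side, and removing it leaves a subdivision of a smaller trapezoid. Hence the number
  \<open>f(a, c)\<close> of subdivisions with right-hand side \<open>(a, 0) -- (c, 1)\<close> is the sum of \<open>f\<close> over all smaller
  admissible pairs, with \<open>f(0, 0) = 1\<close>. For the partial sums \<open>G(a, c)\<close> of \<open>f\<close>, which equal \<open>2 f(a, c)\<close>
  away from the origin, inclusion-exclusion gives
  \<open>G(a + 1, c + 1) = 2 (G(a + 1, c) + G(a, c + 1) - G(a, c))\<close>. Writing \<open>G(a, c) = 2^c h\<^sub>a(c)\<close>, this reads
  \<open>h\<^sub>a\<^sub>+\<^sub>1(c + 1) - h\<^sub>a\<^sub>+\<^sub>1(c) = 2 h\<^sub>a(c + 1) - h\<^sub>a(c)\<close>, so \<open>h\<^sub>a\<close> is a polynomial of degree \<open>a\<close> with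
  leading coefficient \<open>1 / a!\<close>. The halving at the origin is the convention for the degenerate grid.\<close>

section \<open>Trapezoids\<close>

text \<open>A pair \<open>u\<close> encodes the segment from \<open>(fst u, 0)\<close> to \<open>(snd u, 1)\<close>; \<open>line u y\<close> is its abscissa at
  height \<open>y\<close>.\<close>

definition line :: "nat \<times> nat \<Rightarrow> real \<Rightarrow> real" where
  "line u y = (1 - y) * real (fst u) + y * real (snd u)"

definition trap :: "nat \<times> nat \<Rightarrow> nat \<times> nat \<Rightarrow> (real \<times> real) set" where
  "trap u v = {p. 0 \<le> snd p \<and> snd p \<le> 1 \<and> line u (snd p) \<le> fst p \<and> fst p \<le> line v (snd p)}"

text \<open>An explicit open subset of the interior, so that overlaps of polygons can be exhibited
  by inequalities.\<close>

definition open_trap :: "nat \<times> nat \<Rightarrow> nat \<times> nat \<Rightarrow> (real \<times> real) set" where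
  "open_trap u v = {p. 0 < snd p \<and> snd p < 1 \<and> line u (snd p) < fst p \<and> fst p < line v (snd p)}"

lemma line_0 [simp]: "line u 0 = real (fst u)"
  and line_1 [simp]: "line u 1 = real (snd u)"
  by (auto simp: line_def)

lemma line_mono: "u \<le> v \<Longrightarrow> 0 \<le> y \<Longrightarrow> y \<le> 1 \<Longrightarrow> line u y \<le> line v y"
  unfolding line_def less_eq_prod_def by (intro add_mono mult_left_mono) auto

text \<open>At an interior height both weights are positive, so nonnegative coordinate differences
  with vanishing weighted sum are both zero.\<close>

lemma line_eq_imp:
  assumes "u \<le> v" "line u y = line v y" "0 < y" "y < 1"
  shows "u = v"
proof -
  have *: "(1 - y) * (real (fst v) - real (fst u)) + y * (real (snd v) - real (snd u)) = 0"
    using assms(2) by (simp add: line_def algebra_simps)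
  have 1: "(1 - y) * (real (fst v) - real (fst u)) \<ge> 0" "y * (real (snd v) - real (snd u)) \<ge> 0"
    using assms by (auto simp: less_eq_prod_def)
  have "(1 - y) * (real (fst v) - real (fst u)) = 0" "y * (real (snd v) - real (snd u)) = 0"
    using * 1 by linarith+
  then show ?thesis using assms by (auto simp: prod_eq_iff)
qed

lemma line_strict_mono: "u < v \<Longrightarrow> 0 < y \<Longrightarrow> y < 1 \<Longrightarrow> line u y < line v y"
  by (metis line_eq_imp line_mono less_le less_le_not_le)

text \<open>The order on pairs compares heights 0 and 1, which the hypothesis leaves out; continuity
  carries the inequality to the closed interval.\<close>

lemma le_if_line_le:
  assumes "\<And>y. 0 < y \<Longrightarrow> y < 1 \<Longrightarrow> line u y \<le> line v y"
  shows "u \<le> v"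
proof -
  have *: "line u y - line v y \<le> 0" if "y \<in> {0..1}" for y
  proof (rule continuous_le_on_closure[where S = "{0<..<1::real}" and f = "\<lambda>y. line u y - line v y"])
    show "continuous_on (closure {0<..<1}) (\<lambda>y. line u y - line v y)"
      unfolding line_def by (intro continuous_intros)
  qed (use that assms in auto)
  from *[of 0] *[of 1] show ?thesis by (simp add: less_eq_prod_def)
qed

lemma line_comb:
  assumes "s + t = 1"
  shows "line u (s * y + t * z) = s * line u y + t * line u z"
proof -
  have s: "s = 1 - t" using assms by simp
  show ?thesis unfolding s by (simp add: line_def algebra_simps)
qed

lemma convex_trap: "convex (trap u v)"
proof (rule convexI)
  fix p q :: "real \<times> real" and s t :: real
  assume *: "p \<in> trap u v" "q \<in> trap u v" "0 \<le> s" "0 \<le> t" "s + t = 1"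
  have "s * snd p + t * snd q \<le> s * 1 + t * 1"
    using * unfolding trap_def by (intro add_mono mult_left_mono) auto
  moreover have "0 \<le> s * snd p + t * snd q"
    using * unfolding trap_def by auto
  moreover have "s * line u (snd p) + t * line u (snd q) \<le> s * fst p + t * fst q"
    using * unfolding trap_def by (intro add_mono mult_left_mono) auto
  moreover have "s * fst p + t * fst q \<le> s * line v (snd p) + t * line v (snd q)"
    using * unfolding trap_def by (intro add_mono mult_left_mono) auto
  ultimately show "s *\<^sub>R p + t *\<^sub>R q \<in> trap u v"
    using \<open>s + t = 1\<close> by (simp add: trap_def line_comb)
qed

lemma closed_trap: "closed (trap u v)"
  unfolding trap_def line_def
  by (intro closed_Collect_conj closed_Collect_le continuous_intros)

lemma open_open_trap: "open (open_trap u v)"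
  unfolding open_trap_def line_def
  by (intro open_Collect_conj open_Collect_less continuous_intros)

lemma open_trap_subset_interior: "open_trap u v \<subseteq> interior (trap u v)"
  by (rule interior_maximal[OF _ open_open_trap]) (auto simp: open_trap_def trap_def)

lemma line_in_trap:
  assumes "u \<le> v" "0 \<le> y" "y \<le> 1"
  shows "(line u y, y) \<in> trap u v" "(line v y, y) \<in> trap u v"
  using assms line_mono[OF assms] by (auto simp: trap_def)

lemma trap_mono: "w \<le> u \<Longrightarrow> v \<le> z \<Longrightarrow> trap u v \<subseteq> trap w z"
  unfolding trap_def by (auto intro: order_trans line_mono)

text \<open>The four corners lie in \<open>trap u v\<close> because \<open>u \<le> v\<close>, and
  testing them in the larger trapezoid yields both inequalities.\<close>

lemma trap_subsetD:
  assumes "trap u v \<subseteq> trap w z" "u \<le> v"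
  shows "w \<le> u" "v \<le> z"
proof -
  have "(line u 0, 0) \<in> trap w z" "(line u 1, 1) \<in> trap w z"
       "(line v 0, 0) \<in> trap w z" "(line v 1, 1) \<in> trap w z"
    using line_in_trap[OF assms(2), of 0] line_in_trap[OF assms(2), of 1] assms(1) by auto
  then show "w \<le> u" "v \<le> z" by (auto simp: trap_def less_eq_prod_def)
qed

lemma trap_inject:
  assumes "trap u v = trap w z" "u \<le> v" "w \<le> z"
  shows "u = w" "v = z"
  using trap_subsetD[of u v w z] trap_subsetD[of w z u v] assms by (auto intro: antisym)

lemma open_trap_nonempty:
  assumes "u < v" shows "open_trap u v \<noteq> {}"
proof -
  have "((line u (1/2) + line v (1/2)) / 2, 1/2) \<in> open_trap u v"
    using line_strict_mono[OF assms, of "1/2"] by (auto simp: open_trap_def field_simps)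
  then show ?thesis by blast
qed

text \<open>Convex combinations along the two bounding segments, and then along the horizontal slice
  between them, reach every point.\<close>

lemma trap_eq_hull:
  assumes "u \<le> v"
  shows "trap u v = convex hull {(real (fst u), 0), (real (fst v), 0), (real (snd u), 1), (real (snd v), 1)}"
    (is "_ = convex hull ?C")
proof
  show "convex hull ?C \<subseteq> trap u v"
    using assms by (intro hull_minimal convex_trap) (auto simp: trap_def less_eq_prod_def)
  show "trap u v \<subseteq> convex hull ?C"
  proof
    fix p assume p: "p \<in> trap u v"
    obtain x y where xy: "p = (x, y)" by force
    have y: "0 \<le> y" "y \<le> 1" "line u y \<le> x" "x \<le> line v y" using p xy by (auto simp: trap_def)
    have L: "(line w y, y) \<in> convex hull ?C" if "w = u \<or> w = v" for w
    proof -
      have "(1 - y) *\<^sub>R (real (fst w), 0::real) + y *\<^sub>R (real (snd w), 1) \<in> convex hull ?C"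
        using y that by (intro convexD[OF convex_convex_hull]) (auto intro: hull_inc)
      then show ?thesis by (simp add: line_def)
    qed
    show "p \<in> convex hull ?C"
    proof (cases "line u y = line v y")
      case True
      then show ?thesis using L[of u] xy y by simp
    next
      case False
      \<comment> \<open>The slice at height \<open>y\<close> is nondegenerate here; \<open>t\<close>
        is the relative position of the point in it.\<close>
      define t where "t = (x - line u y) / (line v y - line u y)"
      have "0 \<le> t" "t \<le> 1" using y False by (auto simp: t_def)
      then have "(1 - t) *\<^sub>R (line u y, y) + t *\<^sub>R (line v y, y) \<in> convex hull ?C"
        by (intro convexD[OF convex_convex_hull] L) auto
      moreover have "t * (line v y - line u y) = x - line u y" using False by (simp add: t_def)
      then have "(1 - t) *\<^sub>R (line u y, y) + t *\<^sub>R (line v y, y) = p"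
        by (simp add: xy algebra_simps)
      ultimately show ?thesis by simp
    qed
  qed
qed

text \<open>Moving any point slightly towards a fixed point of \<open>open_trap u v\<close> makes
  all four defining inequalities strict, and the moved points converge back.\<close>

lemma trap_subset_closure:
  assumes "u < v"
  shows "trap u v \<subseteq> closure (open_trap u v)"
proof
  fix p assume p: "p \<in> trap u v"
  obtain q where q: "q \<in> open_trap u v" using open_trap_nonempty[OF assms] by blast
  define f where "f n = (1 - inverse (real (Suc n))) *\<^sub>R p + inverse (real (Suc n)) *\<^sub>R q" for n
  have "f n \<in> open_trap u v" for n
  proof -
    obtain s t where st: "0 \<le> s" "0 < t" "s + t = 1"
      and f: "f n = s *\<^sub>R p + t *\<^sub>R q"
    proof
      show "f n = (1 - inverse (real (Suc n))) *\<^sub>R p + inverse (real (Suc n)) *\<^sub>R q"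
        by (rule f_def)
    qed (auto simp: field_simps)
    have "s * snd p + t * snd q < s * 1 + t * 1"
      using p q st unfolding trap_def open_trap_def by (intro add_le_less_mono mult_left_mono mult_strict_left_mono) auto
    then have "s * snd p + t * snd q < 1" by (simp add: st(3))
    moreover have "s * 0 + t * 0 < s * snd p + t * snd q"
      using p q st unfolding trap_def open_trap_def by (intro add_le_less_mono mult_left_mono mult_strict_left_mono) auto
    moreover have "s * line u (snd p) + t * line u (snd q) < s * fst p + t * fst q"
      using p q st unfolding trap_def open_trap_def by (intro add_le_less_mono mult_left_mono mult_strict_left_mono) auto
    moreover have "s * fst p + t * fst q < s * line v (snd p) + t * line v (snd q)"
      using p q st unfolding trap_def open_trap_def by (intro add_le_less_mono mult_left_mono mult_strict_left_mono) auto
    ultimately show ?thesis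
      unfolding f by (simp add: open_trap_def line_comb[OF st(3)])
  qed
  moreover have "f \<longlonglongrightarrow> (1 - 0) *\<^sub>R p + 0 *\<^sub>R q"
    unfolding f_def by (intro tendsto_intros LIMSEQ_inverse_real_of_nat)
  ultimately show "p \<in> closure (open_trap u v)"
    unfolding closure_sequential by auto
qed

lemma polytope_trap: "u \<le> v \<Longrightarrow> polytope (trap u v)"
  unfolding trap_eq_hull polytope_def by (rule exI, rule conjI[OF _ refl]) auto

lemma convex_polygon_trap:
  assumes "u < v" shows "convex_polygon (trap u v)"
proof -
  have "interior (trap u v) \<noteq> {}"
    using open_trap_nonempty[OF assms] open_trap_subset_interior by blast
  then have "aff_dim (trap u v) = 2"
    by (subst aff_dim_nonempty_interior) auto
  then show ?thesis using polytope_trap assms by (auto simp: convex_polygon_def)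
qed

section \<open>Edges and vertices of a trapezoid\<close>

lemma trap_self: "trap u u = closed_segment (real (fst u), 0) (real (snd u), 1)"
  by (simp add: trap_eq_hull segment_convex_hull insert_commute)

lemma aff_dim_trap_self: "aff_dim (trap u u) = 1"
  by (simp add: trap_self segment_convex_hull aff_dim_convex_hull aff_dim_2)

text \<open>The vector is normal to the segment encoded by \<open>u\<close>, so the functional is
  constant on it and measures horizontal displacement from it; this gives the supporting lines of a
  trapezoid.\<close>

lemma inner_line:
  "(1, real (fst u) - real (snd u)) \<bullet> p = fst p - line u (snd p) + real (fst u)"
  by (simp add: line_def inner_prod_def algebra_simps)

lemma trap_self_edge:
  assumes "u \<le> v"
  shows "trap u u edge_of trap u v" "trap v v edge_of trap u v"
proof -
  have "trap u v \<inter> {p. (1, real (fst u) - real (snd u)) \<bullet> p = real (fst u)} face_of trap u v"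
    by (rule face_of_Int_supporting_hyperplane_ge[OF convex_trap]) (auto simp: trap_def inner_line)
  moreover have "trap u v \<inter> {p. (1, real (fst u) - real (snd u)) \<bullet> p = real (fst u)} = trap u u"
    using line_mono[OF assms] by (auto simp: trap_def inner_line)
  ultimately show "trap u u edge_of trap u v" by (simp add: edge_of_def aff_dim_trap_self)
  have "trap u v \<inter> {p. (1, real (fst v) - real (snd v)) \<bullet> p = real (fst v)} face_of trap u v"
    by (rule face_of_Int_supporting_hyperplane_le[OF convex_trap]) (auto simp: trap_def inner_line)
  moreover have "trap u v \<inter> {p. (1, real (fst v) - real (snd v)) \<bullet> p = real (fst v)} = trap v v"
    using line_mono[OF assms] by (auto simp: trap_def inner_line)
  ultimately show "trap v v edge_of trap u v" by (simp add: edge_of_def aff_dim_trap_self)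
qed

text \<open>Each corner is an end point of a bounding segment, and an extreme point of a face is
  extreme in the whole set. Triangles are covered as well, with coinciding corners.\<close>

lemma corners_vertices:
  assumes "u \<le> v" "w = u \<or> w = v"
  shows "(real (fst w), 0) \<in> polygon_vertices (trap u v)" "(real (snd w), 1) \<in> polygon_vertices (trap u v)"
proof -
  have f: "trap w w face_of trap u v" using trap_self_edge[OF assms(1)] assms(2) by (auto simp: edge_of_def)
  show "(real (fst w), 0) \<in> polygon_vertices (trap u v)" "(real (snd w), 1) \<in> polygon_vertices (trap u v)"
    using extreme_point_of_face[OF f] by (auto simp: polygon_vertices_def trap_self extreme_point_of_segment)
qed

lemma vertices_trap:
  assumes "u \<le> v"
  shows "polygon_vertices (trap u v) \<subseteq> {(real (fst u), 0), (real (fst v), 0), (real (snd u), 1), (real (snd v), 1)}"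
  unfolding trap_eq_hull[OF assms] polygon_vertices_def
  using extreme_point_of_convex_hull by blast

text \<open>Horizontal edges have slope 0. Any other edge is a proper face, hence misses the
  interior, and therefore runs along one of the two bounding segments.\<close>

lemma bimonotone_trap:
  assumes "u < v" "fst u \<le> snd u" "fst v \<le> snd v"
  shows "bimonotone_polygon (trap u v)"
  unfolding bimonotone_polygon_def
proof (intro conjI allI impI convex_polygon_trap[OF assms(1)])
  fix p q assume e: "closed_segment p q edge_of trap u v"
  show "fst p = fst q \<or> (snd q - snd p) / (fst q - fst p) \<ge> 0"
  proof (cases "snd p = snd q")
    case False
    have face: "closed_segment p q face_of trap u v" and "aff_dim (closed_segment p q) = 1"
      using e by (auto simp: edge_of_def)
    moreover have "aff_dim (trap u v) = 2"
      using convex_polygon_trap[OF assms(1)] by (simp add: convex_polygon_def)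
    ultimately have "closed_segment p q \<noteq> trap u v" by auto
    then have disj: "closed_segment p q \<inter> interior (trap u v) = {}"
      using face_of_disjoint_interior face by blast
    have pq: "p \<in> trap u v" "q \<in> trap u v" using face_of_imp_subset[OF face] by auto
    have "midpoint p q \<in> closed_segment p q" by simp
    then have m: "midpoint p q \<notin> open_trap u v" using disj open_trap_subset_interior by blast
    have sm: "snd (midpoint p q) = (snd p + snd q) / 2" "fst (midpoint p q) = (fst p + fst q) / 2"
      by (auto simp: midpoint_def)
    have lm: "line w ((snd p + snd q) / 2) = (line w (snd p) + line w (snd q)) / 2" for w
      using line_comb[of "1/2" "1/2" w "snd p" "snd q"] by (simp add: field_simps)
    \<comment> \<open>The midpoint lies strictly between the rows, so outside
      \<open>open_trap u v\<close> it must be on or beyond a bounding line. Both end points satisfy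
      the opposite inequality, and averaging forces equality for each.\<close>
    have "\<exists>w\<in>{u, v}. fst p = line w (snd p) \<and> fst q = line w (snd q)"
    proof -
      have "0 < snd (midpoint p q)" "snd (midpoint p q) < 1"
        using pq False unfolding sm by (auto simp: trap_def)
      then have "fst (midpoint p q) \<le> line u (snd (midpoint p q)) \<or> line v (snd (midpoint p q)) \<le> fst (midpoint p q)"
        using m by (auto simp: open_trap_def)
      then show ?thesis using pq unfolding sm lm by (auto simp: trap_def)
    qed
    then obtain w where w: "fst w \<le> snd w" "fst p = line w (snd p)" "fst q = line w (snd q)"
      using assms by auto
    have "fst q - fst p = (snd q - snd p) * (real (snd w) - real (fst w))"
      using w(2,3) by (simp add: line_def algebra_simps)
    then show ?thesis using w(1) False by (simp add: divide_simps)
  qed simp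
qed

section \<open>Polygons of bimonotone subdivisions\<close>

text \<open>Forces a two-dimensional polygon of the grid to have vertices in both rows.\<close>

lemma aff_dim_row_le:
  fixes V :: "(real \<times> real) set"
  assumes "V \<subseteq> {p. snd p = r}"
  shows "aff_dim (convex hull V) \<le> 1"
proof -
  have "aff_dim V \<le> aff_dim {p::real \<times> real. (0, 1) \<bullet> p = r}"
    using assms by (intro aff_dim_subset) (auto simp: inner_prod_def)
  also have "\<dots> = 1" by (subst aff_dim_hyperplane) (auto simp: zero_prod_def)
  finally show ?thesis by (simp add: aff_dim_convex_hull)
qed

text \<open>A polytope is the hull of its extreme points. These lie in two rows, so the leftmost and
  rightmost vertex of each row span it. The two bounding segments are then edges, and bimonotonicity
  makes them lean to the right or stand vertically.\<close>

lemma bimonotone_polygon_is_trap: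
  assumes K: "bimonotone_polygon K" and V: "polygon_vertices K \<subseteq> two_row_grid m n"
  obtains u v where "K = trap u v" "u < v" "fst u \<le> snd u" "fst v \<le> snd v"
proof -
  have poly: "polytope K" and dim: "aff_dim K = 2"
    using K by (auto simp: bimonotone_polygon_def convex_polygon_def)
  define V where "V = polygon_vertices K"
  have hull: "K = convex hull V"
    unfolding V_def polygon_vertices_def
    using Krein_Milman_Minkowski poly polytope_imp_compact polytope_imp_convex by blast
  define B where "B = {i. (real i, 0) \<in> V}"
  define T where "T = {i. (real i, 1) \<in> V}"
  have Bn: "B \<subseteq> {..<n}" and Tm: "T \<subseteq> {..<m}"
    using V by (auto simp: B_def T_def V_def two_row_grid_def)
  have fin: "finite B" "finite T" using Bn Tm finite_subset by auto
  have V_eq: "p \<in> V \<longleftrightarrow> (\<exists>i\<in>B. p = (real i, 0)) \<or> (\<exists>i\<in>T. p = (real i, 1))" for p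
    using V by (auto simp: B_def T_def V_def two_row_grid_def)
  have "B \<noteq> {}"
    using aff_dim_row_le[of V 1] dim hull V_eq by fastforce
  have "T \<noteq> {}"
    using aff_dim_row_le[of V 0] dim hull V_eq by fastforce
  define u where "u = (Min B, Min T)"
  define v where "v = (Max B, Max T)"
  have inB: "Min B \<in> B" "Max B \<in> B" and inT: "Min T \<in> T" "Max T \<in> T"
    using fin \<open>B \<noteq> {}\<close> \<open>T \<noteq> {}\<close> by auto
  have uv: "u \<le> v" using fin inB inT by (auto simp: u_def v_def less_eq_prod_def)
  have K_eq: "K = trap u v"
  proof
    have "V \<subseteq> trap u v"
      using fin by (auto simp: V_eq trap_def u_def v_def)
    then show "K \<subseteq> trap u v" unfolding hull by (intro hull_minimal convex_trap)
    show "trap u v \<subseteq> K"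
      unfolding hull trap_eq_hull[OF uv] using inB inT
      by (intro hull_mono) (auto simp: u_def v_def V_eq)
  qed
  have "u \<noteq> v" using dim K_eq aff_dim_trap_self[of u] by auto
  moreover have "fst w \<le> snd w" if "trap w w edge_of K" for w
  proof -
    \<comment> \<open>The edge is read from bottom to top, so the rise is 1 and the sign of the
      slope is that of the run.\<close>
    have "real (fst w) = real (snd w) \<or> (1 - 0) / (real (snd w) - real (fst w)) \<ge> 0"
      using K that unfolding bimonotone_polygon_def trap_self by fastforce
    then show ?thesis by auto
  qed
  ultimately show ?thesis using that[OF K_eq] uv trap_self_edge[OF uv] K_eq by auto
qed

text \<open>The pairwise condition of \<open>subdivision\<close>, isolated to be reasoned about on
  its own.\<close>

definition meets :: "(real \<times> real) set \<Rightarrow> (real \<times> real) set \<Rightarrow> bool" where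
  "meets K L \<longleftrightarrow> K \<inter> L = {} \<or>
        (\<exists>v \<in> polygon_vertices K \<inter> polygon_vertices L. K \<inter> L = {v}) \<or>
        (K \<inter> L edge_of K \<and> K \<inter> L edge_of L)"

lemma meets_commute: "meets K L \<longleftrightarrow> meets L K"
  by (auto simp: meets_def Int_commute)

text \<open>The empty set, a point and an edge all have dimension at most 1, hence empty interior in
  the plane.\<close>

lemma meets_interior:
  assumes "meets K L"
  shows "interior K \<inter> interior L = {}"
proof -
  have "aff_dim (K \<inter> L) \<le> 1" using assms by (auto simp: meets_def edge_of_def)
  then have "interior (K \<inter> L) = {}"
    using aff_dim_nonempty_interior[of "K \<inter> L"] by fastforce
  then show ?thesis by simp
qed

lemma meets_open_trap:
  assumes "meets (trap u v) (trap w z)"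
  shows "open_trap u v \<inter> open_trap w z = {}"
  using meets_interior[OF assms] open_trap_subset_interior by blast

section \<open>Removing the rightmost polygon\<close>

text \<open>The strict product order \<open>u < v\<close> allows one coordinate to agree, which
  gives the triangles.\<close>

definition bitraps :: "(real \<times> real) set set" where
  "bitraps = {trap u v |u v. u < v \<and> fst u \<le> snd u \<and> fst v \<le> snd v}"

text \<open>For the degenerate region the empty collection counts as a subdivision, although its union is
  not the segment; this starts the recursion.\<close>

definition tilings :: "nat \<times> nat \<Rightarrow> (real \<times> real) set set set" where
  "tilings e = (if e = (0, 0) then {{}} else
     {S. S \<subseteq> bitraps \<and> (\<forall>K\<in>S. \<forall>L\<in>S. K \<noteq> L \<longrightarrow> meets K L) \<and> \<Union>S = trap (0, 0) e})"

lemma origin_le [simp]: "(0, 0) \<le> (e :: nat \<times> nat)"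
  by (simp add: less_eq_prod_def)

lemma finite_le_pair: "finite {u :: nat \<times> nat. u \<le> e}"
proof -
  have "{u. u \<le> e} \<subseteq> {..fst e} \<times> {..snd e}" by (auto simp: less_eq_prod_def)
  then show ?thesis by (rule finite_subset) auto
qed

lemma tiling_elem:
  assumes "S \<in> tilings e" "K \<in> S"
  obtains u v where "K = trap u v" "u < v" "v \<le> e" "fst u \<le> snd u" "fst v \<le> snd v"
proof -
  have e: "e \<noteq> (0, 0)" using assms by (auto simp: tilings_def)
  then obtain u v where uv: "K = trap u v" "u < v" "fst u \<le> snd u" "fst v \<le> snd v"
    using assms by (force simp: tilings_def bitraps_def)
  have "trap u v \<subseteq> trap (0, 0) e" using e assms uv by (auto simp: tilings_def)
  then have "v \<le> e" using trap_subsetD uv by auto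
  then show ?thesis using uv that by blast
qed

lemma finite_tiling:
  assumes "S \<in> tilings e" shows "finite S"
proof -
  have "S \<subseteq> (\<lambda>(u, v). trap u v) ` ({u. u \<le> e} \<times> {u. u \<le> e})"
  proof
    fix K assume "K \<in> S"
    then obtain u v where "K = trap u v" "u < v" "v \<le> e" using tiling_elem[OF assms] by metis
    then show "K \<in> (\<lambda>(u, v). trap u v) ` ({u. u \<le> e} \<times> {u. u \<le> e})" by force
  qed
  then show ?thesis by (rule finite_subset) (auto intro: finite_le_pair)
qed

text \<open>Two trapezoids with the same right-hand side overlap just to the left of its midpoint,
  so they cannot be distinct members of one tiling. This makes the decomposition by last polygon
  unambiguous.\<close>

lemma tiling_unique_last:
  assumes "S \<in> tilings e" "trap u e \<in> S" "trap w e \<in> S" "u < e" "w < e"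
  shows "u = w"
proof (rule ccontr)
  assume "u \<noteq> w"
  then have "trap u e \<noteq> trap w e" using trap_inject(1)[of u e w e] assms(4,5) less_imp_le by blast
  then have "meets (trap u e) (trap w e)" using assms by (auto simp: tilings_def split: if_splits)
  then have "open_trap u e \<inter> open_trap w e = {}" by (rule meets_open_trap)
  moreover define x where "x = (max (line u (1/2)) (line w (1/2)) + line e (1/2)) / 2"
  have "(x, 1/2) \<in> open_trap u e \<inter> open_trap w e"
    using line_strict_mono[OF assms(4), of "1/2"] line_strict_mono[OF assms(5), of "1/2"]
    by (auto simp: open_trap_def x_def max_def field_simps)
  ultimately show False by blast
qed

lemma trap_split:
  assumes "w \<le> u" "u \<le> e"
  shows "trap w e = trap w u \<union> trap u e"
proof
  show "trap w e \<subseteq> trap w u \<union> trap u e" by (auto simp: trap_def)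
  show "trap w u \<union> trap u e \<subseteq> trap w e"
    using trap_mono[of w w u e] trap_mono[of w u e e] assms by simp
qed

text \<open>Since \<open>v \<le> u\<close>, the two trapezoids can touch only where the segments of
  \<open>v\<close> and \<open>u\<close> meet: everywhere, at the bottom end, at the top end, or
  nowhere. These cases match the alternatives in \<open>meets\<close>.\<close>

lemma meets_traps:
  assumes "w < v" "v \<le> u" "u < e"
  shows "meets (trap u e) (trap w v)"
proof -
  have le: "u \<le> e" "w \<le> v" using assms by (auto simp: less_imp_le)
  have I: "trap u e \<inter> trap w v = {p. 0 \<le> snd p \<and> snd p \<le> 1 \<and> fst p = line u (snd p) \<and> fst p = line v (snd p)}"
    using line_mono[OF \<open>v \<le> u\<close>] line_mono[OF le(1)] line_mono[OF le(2)]
    by (force simp: trap_def)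
  consider "fst v = fst u" "snd v = snd u" | "fst v = fst u" "snd v < snd u" | "snd v = snd u" "fst v < fst u"
    | "fst v < fst u" "snd v < snd u"
    using \<open>v \<le> u\<close> unfolding less_eq_prod_def le_less by blast
  then show ?thesis
  proof cases
    case 1
    then have "v = u" by (simp add: prod_eq_iff)
    moreover from this have "trap u e \<inter> trap w v = trap u u" unfolding I by (auto simp: trap_def)
    ultimately show ?thesis
      using trap_self_edge(1)[OF le(1)] trap_self_edge(2)[OF le(2)] by (simp add: meets_def)
  next
    case 2
    have "trap u e \<inter> trap w v = {(real (fst u), 0)}"
      unfolding I using 2 by (auto simp: line_def)
    moreover have "(real (fst u), 0) \<in> polygon_vertices (trap u e) \<inter> polygon_vertices (trap w v)"
      using corners_vertices(1)[OF le(1), of u] corners_vertices(1)[OF le(2), of v] 2 by simp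
    ultimately show ?thesis by (auto simp: meets_def)
  next
    case 3
    have "trap u e \<inter> trap w v = {(real (snd u), 1)}"
      unfolding I using 3 by (auto simp: line_def)
    moreover have "(real (snd u), 1) \<in> polygon_vertices (trap u e) \<inter> polygon_vertices (trap w v)"
      using corners_vertices(2)[OF le(1), of u] corners_vertices(2)[OF le(2), of v] 3 by simp
    ultimately show ?thesis by (auto simp: meets_def)
  next
    case 4
    have "line v y \<noteq> line u y" if "0 \<le> y" "y \<le> 1" for y
    proof (cases "0 < y \<and> y < 1")
      case True
      then show ?thesis using line_eq_imp[OF \<open>v \<le> u\<close>, of y] 4 by auto
    next
      case False
      then have "y = 0 \<or> y = 1" using that by auto
      then show ?thesis using 4 by auto
    qed
    then have "trap u e \<inter> trap w v = {}" unfolding I by fastforce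
    then show ?thesis by (simp add: meets_def)
  qed
qed

lemma tiling_insert:
  assumes S: "S \<in> tilings u" and u: "u < e" "fst u \<le> snd u" "fst e \<le> snd e"
  shows "insert (trap u e) S \<in> tilings e" "trap u e \<notin> S"
proof -
  have e: "e \<noteq> (0, 0)" using u(1) origin_le[of u] by (auto simp: less_le_not_le)
  show "trap u e \<notin> S"
  proof
    assume "trap u e \<in> S"
    then obtain w v where wv: "trap u e = trap w v" "w < v" "v \<le> u" using tiling_elem[OF S] by metis
    then have "e = v" using trap_inject(2)[OF wv(1)] u(1) by (blast intro: less_imp_le)
    then show False using wv(3) u(1) by (simp add: less_le_not_le)
  qed
  have "trap u e \<in> bitraps" using u unfolding bitraps_def by blast
  moreover have "S \<subseteq> bitraps" using S by (auto simp: tilings_def split: if_splits)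
  moreover have *: "meets (trap u e) L" if "L \<in> S" for L
    using tiling_elem[OF S that] meets_traps u by metis
  moreover have "meets K L" if "K \<in> S" "L \<in> S" "K \<noteq> L" for K L
    using S that by (auto simp: tilings_def split: if_splits)
  \<comment> \<open>The empty tiling at the origin does not cover its segment, but there the new
    trapezoid is already the whole region.\<close>
  moreover have "\<Union>(insert (trap u e) S) = trap (0, 0) e"
  proof (cases "u = (0, 0)")
    case True
    then show ?thesis using S by (simp add: tilings_def)
  next
    case False
    then show ?thesis using S trap_split[of "(0,0)" u e] less_imp_le[OF u(1)] by (auto simp: tilings_def)
  qed
  ultimately show "insert (trap u e) S \<in> tilings e"
    using e meets_commute by (auto simp: tilings_def)
qed

text \<open>A polygon containing the midpoint of the right-hand side has a right side touching that
  of the region at an interior height; by \<open>line_eq_imp\<close> the two sides coincide. All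
  other polygons then lie to the left of this one and tile what remains.\<close>

lemma tiling_remove_last:
  assumes S: "S \<in> tilings e" and e: "e \<noteq> (0, 0)"
  obtains u where "u < e" "fst u \<le> snd u" "trap u e \<in> S" "S - {trap u e} \<in> tilings u"
proof -
  have SU: "\<Union>S = trap (0, 0) e" and Sm: "\<And>K L. K \<in> S \<Longrightarrow> L \<in> S \<Longrightarrow> K \<noteq> L \<Longrightarrow> meets K L"
    and Sb: "S \<subseteq> bitraps"
    using S e by (auto simp: tilings_def)
  have "(line e (1/2), 1/2) \<in> \<Union>S" unfolding SU by (rule line_in_trap) auto
  then obtain K where K: "K \<in> S" "(line e (1/2), 1/2) \<in> K" by blast
  obtain u v where uv: "K = trap u v" "u < v" "v \<le> e" "fst u \<le> snd u"
    using tiling_elem[OF S K(1)] by metis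
  have "line e (1/2) \<le> line v (1/2)" using K uv by (auto simp: trap_def)
  then have "line v (1/2) = line e (1/2)" using line_mono[OF uv(3), of "1/2"] by simp
  then have "v = e" using line_eq_imp[OF uv(3)] by simp
  then have u: "u < e" "trap u e \<in> S" using uv K by auto
  define S' where "S' = S - {trap u e}"
  have below: "\<exists>w v. L = trap w v \<and> w < v \<and> v \<le> u" if L: "L \<in> S'" for L
  proof -
    have "L \<in> S" "L \<noteq> trap u e" using L by (auto simp: S'_def)
    obtain w v where wv: "L = trap w v" "w < v" "v \<le> e"
      using tiling_elem[OF S \<open>L \<in> S\<close>] by metis
    have disj: "open_trap u e \<inter> open_trap w v = {}"
      using meets_open_trap Sm[OF u(2) \<open>L \<in> S\<close>] \<open>L \<noteq> trap u e\<close> wv by auto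
    \<comment> \<open>If \<open>L\<close> reached beyond \<open>u\<close> at height
      \<open>y\<close>, the point halfway between the larger left boundary and the right boundary of
      \<open>L\<close> would lie in both open trapezoids, since \<open>v \<le> e\<close>.\<close>
    have "line v y \<le> line u y" if y: "0 < y" "y < 1" for y
    proof (rule ccontr)
      assume "\<not> line v y \<le> line u y"
      moreover define x where "x = (max (line u y) (line w y) + line v y) / 2"
      ultimately have "(x, y) \<in> open_trap u e \<inter> open_trap w v"
        using line_strict_mono[OF wv(2) y] line_mono[OF wv(3), of y] y
        by (auto simp: open_trap_def x_def max_def field_simps)
      then show False using disj by blast
    qed
    then have "v \<le> u" by (rule le_if_line_le)
    then show ?thesis using wv by blast
  qed
  have "S' \<in> tilings u"
  proof (cases "u = (0, 0)")
    case True
    \<comment> \<open>No trapezoid fits into the degenerate region, in agreement with the convention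
      for \<open>tilings (0, 0)\<close>.\<close>
    have "S' = {}"
    proof (rule ccontr)
      assume "S' \<noteq> {}"
      then obtain w v :: "nat \<times> nat" where "w < v" "v \<le> (0, 0)" using below True by blast
      then show False by (auto simp: less_eq_prod_def less_le_not_le)
    qed
    then show ?thesis using True by (simp add: tilings_def)
  next
    case False
    have "\<Union>S' = trap (0, 0) u"
    proof
      have "L \<subseteq> trap (0, 0) u" if "L \<in> S'" for L
        using below[OF that] trap_mono[of "(0,0)"] origin_le by blast
      then show "\<Union>S' \<subseteq> trap (0, 0) u" by blast
      \<comment> \<open>Points strictly to the left of \<open>u\<close> avoid the removed polygon.
        The boundary is recovered afterwards, because a finite union of closed polygons is
        closed.\<close>
      have "open_trap (0, 0) u \<subseteq> \<Union>S'"
      proof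
        fix p assume p: "p \<in> open_trap (0, 0) u"
        then have "p \<in> trap (0, 0) e" using trap_mono[of "(0,0)" "(0,0)" u e] less_imp_le[OF u(1)]
          by (auto simp: open_trap_def trap_def[of "(0,0)" u])
        moreover have "p \<notin> trap u e" using p by (auto simp: open_trap_def trap_def)
        ultimately show "p \<in> \<Union>S'" using SU by (auto simp: S'_def)
      qed
      moreover have "closed (\<Union>S')"
      proof (rule closed_Union)
        show "finite S'" using finite_tiling[OF S] by (simp add: S'_def)
        show "\<forall>L\<in>S'. closed L" using below closed_trap by blast
      qed
      ultimately have "closure (open_trap (0, 0) u) \<subseteq> \<Union>S'" by (rule closure_minimal)
      moreover have "(0, 0) < u" using False by (simp add: less_le)
      ultimately show "trap (0, 0) u \<subseteq> \<Union>S'" using trap_subset_closure by blast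
    qed
    then show ?thesis using False Sb Sm by (auto simp: tilings_def S'_def)
  qed
  then show ?thesis using that u uv(4) by (simp add: S'_def)
qed

text \<open>The candidates for the left side of the last polygon, that is, for the right side of the
  remaining region.\<close>

abbreviation steps :: "nat \<times> nat \<Rightarrow> (nat \<times> nat) set" where
  "steps e \<equiv> {u. u < e \<and> fst u \<le> snd u}"

lemma finite_steps: "finite (steps e)"
  by (rule finite_subset[OF _ finite_le_pair[of e]]) auto

lemma tilings_rec:
  assumes "e \<noteq> (0, 0)" "fst e \<le> snd e"
  shows "tilings e = (\<Union>u\<in>steps e. insert (trap u e) ` tilings u)"
proof (intro equalityI subsetI)
  fix S assume S: "S \<in> tilings e"
  obtain u where "u < e" "fst u \<le> snd u" "trap u e \<in> S" "S - {trap u e} \<in> tilings u"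
    using tiling_remove_last[OF S assms(1)] .
  moreover from this have "S = insert (trap u e) (S - {trap u e})" by blast
  ultimately show "S \<in> (\<Union>u\<in>steps e. insert (trap u e) ` tilings u)" by blast
next
  fix S assume "S \<in> (\<Union>u\<in>steps e. insert (trap u e) ` tilings u)"
  then show "S \<in> tilings e" using tiling_insert(1) assms(2) by blast
qed

lemma finite_tilings: "fst e \<le> snd e \<Longrightarrow> finite (tilings e)"
proof (induction "fst e + snd e" arbitrary: e rule: less_induct)
  case less
  show ?case
  proof (cases "e = (0, 0)")
    case False
    have "finite (tilings u)" if "u \<in> steps e" for u
    proof (rule less.hyps)
      show "fst u + snd u < fst e + snd e"
        using that by (auto simp: less_le_not_le less_eq_prod_def)
    qed (use that in auto)
    then show ?thesis unfolding tilings_rec[OF False less.prems] using finite_steps by auto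
  qed (simp add: tilings_def)
qed

text \<open>The union in \<open>tilings_rec\<close> is disjoint by
  \<open>tiling_unique_last\<close>, and inserting a polygon that the tiling does not contain is
  injective.\<close>

lemma card_tilings_rec:
  assumes "e \<noteq> (0, 0)" "fst e \<le> snd e"
  shows "card (tilings e) = (\<Sum>u\<in>steps e. card (tilings u))"
proof -
  have "card (tilings e) = (\<Sum>u\<in>steps e. card (insert (trap u e) ` tilings u))"
    unfolding tilings_rec[OF assms]
  proof (rule card_UN_disjoint)
    show "\<forall>u\<in>steps e. \<forall>w\<in>steps e. u \<noteq> w \<longrightarrow>
      insert (trap u e) ` tilings u \<inter> insert (trap w e) ` tilings w = {}"
    proof (intro ballI impI, rule ccontr)
      fix u w assume uw: "u \<in> steps e" "w \<in> steps e" "u \<noteq> w"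
        and "insert (trap u e) ` tilings u \<inter> insert (trap w e) ` tilings w \<noteq> {}"
      then obtain S where "S \<in> insert (trap u e) ` tilings u" "S \<in> insert (trap w e) ` tilings w" by blast
      moreover from this have "S \<in> tilings e" using uw tilings_rec[OF assms] by blast
      ultimately show False using tiling_unique_last[of S e u w] uw by auto
    qed
  qed (use finite_steps finite_tilings in blast)+
  also have "\<dots> = (\<Sum>u\<in>steps e. card (tilings u))"
  proof (rule sum.cong[OF refl])
    fix u assume "u \<in> steps e"
    then have "trap u e \<notin> S" if "S \<in> tilings u" for S using tiling_insert(2)[OF that] assms by auto
    then have "inj_on (insert (trap u e)) (tilings u)"
      by (intro inj_onI) (metis insert_ident)
    then show "card (insert (trap u e) ` tilings u) = card (tilings u)" by (rule card_image)
  qed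
  finally show ?thesis .
qed

section \<open>Bimonotone subdivisions of the grid as tilings\<close>

text \<open>Pairs list the bottom abscissa first, so \<open>m\<close> and \<open>n\<close> change
  places, and the last abscissa of a row is one less than its number of points.\<close>

lemma convex_hull_two_row_grid:
  assumes "m \<ge> 1" "n \<ge> 1"
  shows "convex hull (two_row_grid m n) = trap (0, 0) (n - 1, m - 1)"
proof
  show "convex hull (two_row_grid m n) \<subseteq> trap (0, 0) (n - 1, m - 1)"
    by (intro hull_minimal convex_trap) (auto simp: two_row_grid_def trap_def)
  show "trap (0, 0) (n - 1, m - 1) \<subseteq> convex hull (two_row_grid m n)"
    using assms unfolding trap_eq_hull[OF origin_le]
    by (intro hull_mono) (auto simp: two_row_grid_def intro: exI[of _ "n - 1"] exI[of _ "m - 1"])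
qed

text \<open>The covering and meeting conditions agree on both sides. Inside the covered region,
  being a member of \<open>bitraps\<close> is equivalent to being bimonotone with vertices in the
  grid; containment in the region supplies the coordinate bounds.\<close>

lemma bimonotone_subdivisions_eq_tilings:
  assumes "n \<ge> 1" "m \<ge> n" "m \<noteq> 1"
  shows "{S. bimonotone_subdivision (two_row_grid m n) S} = tilings (n - 1, m - 1)"
proof -
  have e: "(n - 1, m - 1) \<noteq> (0, 0)" and m: "m \<ge> 1" using assms by auto
  have "(K \<in> bitraps) \<longleftrightarrow> bimonotone_polygon K \<and> polygon_vertices K \<subseteq> two_row_grid m n"
    if sub: "K \<subseteq> trap (0, 0) (n - 1, m - 1)" for K
  proof
    assume "K \<in> bitraps"
    then obtain u v where uv: "K = trap u v" "u < v" "fst u \<le> snd u" "fst v \<le> snd v"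
      by (auto simp: bitraps_def)
    have "v \<le> (n - 1, m - 1)" using trap_subsetD(2) sub uv by auto
    then have "u \<le> (n - 1, m - 1)" "v \<le> (n - 1, m - 1)" using uv by auto
    then have "{(real (fst u), 0), (real (fst v), 0), (real (snd u), 1), (real (snd v), 1)} \<subseteq> two_row_grid m n"
      using assms m by (auto simp: two_row_grid_def less_eq_prod_def)
    then show "bimonotone_polygon K \<and> polygon_vertices K \<subseteq> two_row_grid m n"
      using bimonotone_trap[OF uv(2-4)] vertices_trap[OF less_imp_le[OF uv(2)]] uv(1) by (auto dest: subsetD)
  next
    assume "bimonotone_polygon K \<and> polygon_vertices K \<subseteq> two_row_grid m n"
    then obtain u v where "K = trap u v" "u < v" "fst u \<le> snd u" "fst v \<le> snd v"
      using bimonotone_polygon_is_trap[of K m n] by blast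
    then show "K \<in> bitraps" unfolding bitraps_def by blast
  qed
  then have *: "(\<forall>K\<in>S. K \<in> bitraps) \<longleftrightarrow> (\<forall>K\<in>S. bimonotone_polygon K \<and> polygon_vertices K \<subseteq> two_row_grid m n)"
    if "\<Union>S = trap (0, 0) (n - 1, m - 1)" for S
    using that by blast
  have "bimonotone_subdivision (two_row_grid m n) S \<longleftrightarrow> S \<in> tilings (n - 1, m - 1)" for S
  proof -
    have convex: "convex_polygon K" if "bimonotone_polygon K" for K
      using that by (simp add: bimonotone_polygon_def)
    have "bimonotone_subdivision (two_row_grid m n) S \<longleftrightarrow>
      (\<forall>K\<in>S. bimonotone_polygon K \<and> polygon_vertices K \<subseteq> two_row_grid m n) \<and>
      (\<forall>K\<in>S. \<forall>L\<in>S. K \<noteq> L \<longrightarrow> meets K L) \<and> \<Union>S = trap (0, 0) (n - 1, m - 1)"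
      unfolding bimonotone_subdivision_def subdivision_def convex_hull_two_row_grid[OF m assms(1)]
        meets_def[symmetric] by (iprover intro: ballI convex dest: bspec)
    also have "\<dots> \<longleftrightarrow> (\<forall>K\<in>S. K \<in> bitraps) \<and>
      (\<forall>K\<in>S. \<forall>L\<in>S. K \<noteq> L \<longrightarrow> meets K L) \<and> \<Union>S = trap (0, 0) (n - 1, m - 1)"
      by (simp add: * cong: conj_cong rev_conj_cong)
    also have "\<dots> \<longleftrightarrow> S \<in> tilings (n - 1, m - 1)"
      unfolding tilings_def if_not_P[OF e] mem_Collect_eq subset_eq ..
    finally show ?thesis .
  qed
  then show ?thesis by blast
qed

section \<open>Counting\<close>

text \<open>A scaled monomial of one degree more has a forward difference with the top coefficient
  of \<open>p\<close>; subtracting it leaves a polynomial for the induction hypothesis. A degree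
  bound is used because the remainder may drop further.\<close>

lemma antidifference_poly:
  fixes p :: "real poly"
  assumes "degree p \<le> k"
  shows "\<exists>q. degree q \<le> Suc k \<and> coeff q (Suc k) = coeff p k / real (Suc k) \<and>
    (\<forall>x. poly q (x + 1) - poly q x = poly p x)"
  using assms
proof (induction k arbitrary: p)
  case 0
  then obtain c where "p = [:c:]" by (auto elim: degree_eq_zeroE)
  then show ?case by (intro exI[of _ "[:0, c:]"]) (auto simp: algebra_simps)
next
  case (Suc k)
  \<comment> \<open>The leading term of the difference of \<open>x ^ Suc (Suc k)\<close> has
    coefficient \<open>Suc (Suc k)\<close>, so this scaling matches \<open>coeff p (Suc k)\<close>;
    \<open>d\<close> is the resulting difference.\<close>
  define c where "c = coeff p (Suc k) / real (Suc (Suc k))"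
  define d where "d = smult c ([:1, 1:] ^ Suc (Suc k) - monom 1 (Suc (Suc k)))"
  have d: "coeff d i = c * (real (Suc (Suc k) choose i) - (if i = Suc (Suc k) then 1 else 0))"
    if "i \<le> Suc (Suc k)" for i
    unfolding d_def using coeff_linear_poly_power[OF that, of "1::real" 1] by (simp del: power_Suc)
  have deg_d: "degree d \<le> Suc (Suc k)"
    unfolding d_def
    by (intro order.trans[OF degree_smult_le] degree_diff_le degree_monom_le
        order.trans[OF degree_power_le]) auto
  have "degree (p - d) \<le> k"
  proof (rule degree_le, intro allI impI)
    fix i assume i: "k < i"
    consider "i = Suc k" | "i = Suc (Suc k)" | "i > Suc (Suc k)" using i by linarith
    then show "coeff (p - d) i = 0"
    proof cases
      case 1
      then show ?thesis using d[of i] by (simp add: c_def)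
    next
      case 2
      then show ?thesis using d[of i] Suc.prems by (simp add: coeff_eq_0)
    next
      case 3
      then show ?thesis using deg_d Suc.prems by (simp add: coeff_eq_0)
    qed
  qed
  from Suc.IH[OF this] obtain q where q: "degree q \<le> Suc k"
      "\<And>x. poly q (x + 1) - poly q x = poly (p - d) x" by blast
  show ?case
  proof (intro exI[of _ "q + monom c (Suc (Suc k))"] conjI allI)
    show "degree (q + monom c (Suc (Suc k))) \<le> Suc (Suc k)"
      using q(1) by (intro degree_add_le degree_monom_le) auto
    show "coeff (q + monom c (Suc (Suc k))) (Suc (Suc k)) = coeff p (Suc k) / real (Suc (Suc k))"
      using q(1) by (simp add: coeff_eq_0 c_def)
    fix x
    have "poly d x = c * ((x + 1) ^ Suc (Suc k) - x ^ Suc (Suc k))"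
      by (simp add: d_def poly_monom add.commute del: power_Suc)
    then show "poly (q + monom c (Suc (Suc k))) (x + 1) - poly (q + monom c (Suc (Suc k))) x = poly p x"
      using q(2)[of x] by (simp add: poly_monom algebra_simps del: power_Suc)
  qed
qed

text \<open>Adding a constant preserves differences and adjusts the value at \<open>a\<close>; a
  nonzero top coefficient makes the degree exact.\<close>

lemma antidifference_poly_initial:
  fixes p :: "real poly"
  assumes "degree p \<le> k" "coeff p k \<noteq> 0"
  obtains q where "degree q = Suc k" "lead_coeff q = coeff p k / real (Suc k)" "poly q a = b"
    "\<And>x. poly q (x + 1) = poly q x + poly p x"
proof -
  obtain q where q: "degree q \<le> Suc k" "coeff q (Suc k) = coeff p k / real (Suc k)"
      "\<And>x. poly q (x + 1) - poly q x = poly p x"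
    using antidifference_poly[OF assms(1)] by blast
  define r where "r = q + [:b - poly q a:]"
  have cr: "coeff r (Suc k) = coeff p k / real (Suc k)" using q(2) by (simp add: r_def)
  have "degree r \<le> Suc k" unfolding r_def using q(1) by (intro degree_add_le) auto
  moreover have "degree r \<ge> Suc k" using cr assms(2) by (intro le_degree) simp
  ultimately have "degree r = Suc k" by simp
  then show ?thesis
  proof (rule that)
    show "lead_coeff r = coeff p k / real (Suc k)" using cr \<open>degree r = Suc k\<close> by simp
    show "poly r a = b" by (simp add: r_def)
    show "poly r (x + 1) = poly r x + poly p x" for x using q(3)[of x] by (simp add: r_def)
  qed
qed

section \<open>Partial sums of the numbers of tilings\<close>

definition staircase :: "nat \<Rightarrow> nat \<Rightarrow> (nat \<times> nat) set" where
  "staircase a c = {u. u \<le> (a, c) \<and> fst u \<le> snd u}"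

definition partial_sums :: "nat \<Rightarrow> nat \<Rightarrow> real" where
  "partial_sums a c = (\<Sum>u\<in>staircase a c. real (card (tilings u)))"

lemma finite_staircase: "finite (staircase a c)"
  unfolding staircase_def by (rule finite_subset[OF _ finite_le_pair[of "(a, c)"]]) auto

text \<open>Away from the origin, the terms other than the corner \<open>(a, c)\<close> sum to the
  corner term by \<open>card_tilings_rec\<close>.\<close>

lemma partial_sums_twice:
  assumes "a \<le> c" "c > 0"
  shows "partial_sums a c = 2 * real (card (tilings (a, c)))"
proof -
  have "u \<in> staircase a c \<longleftrightarrow> u \<in> insert (a, c) (steps (a, c))" for u
  proof (cases "u = (a, c)")
    case True
    then show ?thesis using assms(1) by (simp add: staircase_def)
  next
    case False
    then show ?thesis unfolding staircase_def by (simp add: less_le)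
  qed
  then have "staircase a c = insert (a, c) (steps (a, c))" by blast
  then have "partial_sums a c = real (card (tilings (a, c))) + (\<Sum>u\<in>steps (a, c). real (card (tilings u)))"
    unfolding partial_sums_def using finite_steps by simp
  also have "(\<Sum>u\<in>steps (a, c). real (card (tilings u))) = real (card (tilings (a, c)))"
    using card_tilings_rec[of "(a, c)"] assms by simp
  finally show ?thesis by simp
qed

lemma partial_sums_0: "partial_sums 0 c = 2 ^ c"
proof (induction c)
  case 0
  have "staircase 0 0 = {(0, 0)}" by (auto simp: staircase_def less_eq_prod_def prod_eq_iff)
  then show ?case by (simp add: partial_sums_def tilings_def)
next
  case (Suc c)
  have "staircase 0 (Suc c) = insert (0, Suc c) (staircase 0 c)"
    by (auto simp: staircase_def less_eq_prod_def prod_eq_iff)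
  moreover have "(0, Suc c) \<notin> staircase 0 c" by (simp add: staircase_def less_eq_prod_def)
  ultimately have "partial_sums 0 (Suc c) = real (card (tilings (0, Suc c))) + partial_sums 0 c"
    unfolding partial_sums_def using finite_staircase by simp
  then show ?case using partial_sums_twice[of 0 "Suc c"] Suc by simp
qed

text \<open>A top coordinate of at most \<open>a\<close> already bounds the bottom coordinate by
  \<open>a\<close>. This starts the recursion for column \<open>Suc a\<close> on the
  diagonal.\<close>

lemma partial_sums_below_diagonal: "partial_sums (Suc a) a = partial_sums a a"
proof -
  have "staircase (Suc a) a = staircase a a" by (auto simp: staircase_def less_eq_prod_def)
  then show ?thesis by (simp add: partial_sums_def)
qed

text \<open>Inclusion-exclusion handles all terms but the corner, which is half of the left-hand
  side; solving for that side gives the factor 2.\<close>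

lemma partial_sums_rec:
  assumes "a \<le> c"
  shows "partial_sums (Suc a) (Suc c) =
    2 * (partial_sums (Suc a) c + partial_sums a (Suc c) - partial_sums a c)"
proof -
  have "staircase (Suc a) (Suc c) = insert (Suc a, Suc c) (staircase (Suc a) c \<union> staircase a (Suc c))"
    using assms by (auto simp: staircase_def less_eq_prod_def)
  moreover have "(Suc a, Suc c) \<notin> staircase (Suc a) c \<union> staircase a (Suc c)"
    by (simp add: staircase_def less_eq_prod_def)
  ultimately have "partial_sums (Suc a) (Suc c) = real (card (tilings (Suc a, Suc c))) +
      (\<Sum>u\<in>staircase (Suc a) c \<union> staircase a (Suc c). real (card (tilings u)))"
    unfolding partial_sums_def using finite_staircase by simp
  also have "(\<Sum>u\<in>staircase (Suc a) c \<union> staircase a (Suc c). real (card (tilings u))) =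
      partial_sums (Suc a) c + partial_sums a (Suc c) -
      (\<Sum>u\<in>staircase (Suc a) c \<inter> staircase a (Suc c). real (card (tilings u)))"
    unfolding partial_sums_def by (intro sum_Un finite_staircase)
  also have "staircase (Suc a) c \<inter> staircase a (Suc c) = staircase a c"
    by (auto simp: staircase_def less_eq_prod_def)
  finally show ?thesis
    using partial_sums_twice[of "Suc a" "Suc c"] assms by (simp add: partial_sums_def)
qed

lemma partial_sums_poly:
  "\<exists>Q :: real poly. degree Q = a \<and> lead_coeff Q = 1 / fact a \<and>
     (\<forall>c\<ge>a. partial_sums a c = 2 ^ c * poly Q (real c))"
proof (induction a)
  case 0
  show ?case by (intro exI[of _ 1]) (simp add: partial_sums_0)
next
  case (Suc a)
  then obtain Q :: "real poly" where Q: "degree Q = a" "lead_coeff Q = 1 / fact a"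
    "\<And>c. c \<ge> a \<Longrightarrow> partial_sums a c = 2 ^ c * poly Q (real c)" by blast
  \<comment> \<open>The prescribed difference \<open>2 * Q (x + 1) - Q x\<close>; its leading
    coefficient is \<open>2 / fact a - 1 / fact a\<close>, and the antidifference divides it by
    \<open>Suc a\<close>.\<close>
  define R where "R = smult 2 (pcompose Q [:1, 1:]) - Q"
  have dc: "degree (pcompose Q [:1, 1:]) = a" using Q(1) by (simp add: degree_pcompose)
  have "lead_coeff (pcompose Q [:1, 1:]) = 1 / fact a" by (subst lead_coeff_comp) (simp_all add: Q(2))
  then have cR: "coeff R a = 1 / fact a" using Q(1,2) dc by (simp add: R_def)
  have dR: "degree R \<le> a" unfolding R_def using dc Q(1)
    by (intro degree_diff_le order.trans[OF degree_smult_le]) auto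
  \<comment> \<open>The initial value comes from \<open>partial_sums_rec\<close> at
    \<open>c = a\<close>, where \<open>partial_sums_below_diagonal\<close> cancels two terms and
    leaves \<open>2 * partial_sums a (Suc a)\<close>.\<close>
  obtain P where P: "degree P = Suc a" "lead_coeff P = coeff R a / real (Suc a)"
      "poly P (real (Suc a)) = 2 * poly Q (real (Suc a))"
      "\<And>x. poly P (x + 1) = poly P x + poly R x"
    using antidifference_poly_initial[OF dR] cR by (metis divide_eq_0_iff fact_nonzero one_neq_zero)
  have "partial_sums (Suc a) c = 2 ^ c * poly P (real c)" if "Suc a \<le> c" for c
    using that
  proof (induction c rule: dec_induct)
    case base
    show ?case using partial_sums_rec[of a a] partial_sums_below_diagonal Q(3)[of "Suc a"] P(3) by simp
  next
    case (step c)
    have *: "poly P (real (Suc c)) = poly P (real c) + (2 * poly Q (real (Suc c)) - poly Q (real c))"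
      using P(4)[of "real c"] by (simp add: R_def poly_pcompose add.commute)
    have "partial_sums (Suc a) (Suc c) =
        2 * (2 ^ c * poly P (real c) + 2 ^ Suc c * poly Q (real (Suc c)) - 2 ^ c * poly Q (real c))"
      using partial_sums_rec[of a c] step Q(3)[of c] Q(3)[of "Suc c"] by simp
    then show ?case unfolding * by (simp add: algebra_simps)
  qed
  moreover have "lead_coeff P = 1 / fact (Suc a)" using P(2) cR by (simp add: field_simps)
  ultimately show ?case using P(1) by blast
qed

theorem theorem1:
  fixes n :: nat
  assumes "n \<ge> 1"
  shows "\<exists>P :: real poly. lead_coeff P = 1 \<and> degree P = n - 1 \<and>
    (\<forall>m \<ge> n. num_bimonotone_subdivisions m n =
       2 powi (int m - 2) / fact (n - 1) * poly P (real m))"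
proof -
  obtain Q :: "real poly" where Q: "degree Q = n - 1" "lead_coeff Q = 1 / fact (n - 1)"
    "\<And>c. c \<ge> n - 1 \<Longrightarrow> partial_sums (n - 1) c = 2 ^ c * poly Q (real c)"
    using partial_sums_poly[of "n - 1"] by blast
  \<comment> \<open>The shift by one is there because \<open>m\<close> top points end at abscissa
    \<open>m - 1\<close>; the factor makes the polynomial monic.\<close>
  define P where "P = smult (fact (n - 1)) (pcompose Q [:-1, 1:])"
  have "num_bimonotone_subdivisions m n = 2 powi (int m - 2) / fact (n - 1) * poly P (real m)"
    if m: "m \<ge> n" for m
  proof -
    \<comment> \<open>For \<open>m = n = 1\<close> the partial sum is 1, so halving it gives exactly
      the conventional value \<open>1 / 2\<close>.\<close>
    have "num_bimonotone_subdivisions m n = partial_sums (n - 1) (m - 1) / 2"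
    proof (cases "m = 1")
      case True
      then show ?thesis using m assms
        by (simp add: num_bimonotone_subdivisions_def partial_sums_0)
    next
      case False
      then show ?thesis
        using bimonotone_subdivisions_eq_tilings[OF assms m] partial_sums_twice[of "n - 1" "m - 1"] m assms
        by (simp add: num_bimonotone_subdivisions_def)
    qed
    also have "\<dots> = 2 ^ (m - 1) / 2 * poly Q (real (m - 1))"
      using m by (subst Q(3)) auto
    \<comment> \<open>An integer power is needed here, as the exponent is -1 for
      \<open>m = 1\<close>.\<close>
    also have "(2::real) ^ (m - 1) / 2 = 2 powi (int m - 2)"
    proof -
      have *: "int m - 2 = int (m - 1) - 1" using m assms by simp
      show ?thesis unfolding * by (subst power_int_diff) simp_all
    qed
    also have "poly Q (real (m - 1)) = poly P (real m) / fact (n - 1)"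
    proof -
      have "real (m - 1) = - 1 + real m" using m assms by linarith
      then show ?thesis by (simp only: P_def) (simp add: poly_pcompose)
    qed
    finally show ?thesis by simp
  qed
  moreover have "degree P = n - 1" by (simp add: P_def degree_pcompose Q(1))
  moreover have "lead_coeff P = 1"
    unfolding P_def lead_coeff_smult by (subst lead_coeff_comp) (simp_all add: Q(2))
  ultimately show ?thesis by blast
qed

end
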